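(* Let $d,t\geq 1$ be fixed integers. There is a constant $C=C(d,t)$ such that for all integers $m\geq 3$, $$R^{d,t}_2(3;m)< 2^{Cm\log\log m}.$$
   Context: Logarithms are base 2. For a finite point set $P=\{p_1,\dots,p_N\}\subset\mathbb{R}^d$, a binary semi-algebraic relation $E\subset\binom{P}{2}$ of complexity at most $t$ is one for which there are $t$ polynomials $f_1,\dots,f_t\in\mathbb{R}[x_1,\dots,x_{2d}]$ of degree at most $t$ and a Boolean function $\Phi$ with $(p_i,p_j)\in E$ iff $\Phi(f_1(p_i,p_j)\ge0,\dots,f_t(p_i,p_j)\ge0)=1$ (for $i<j$); it is symmetric if this condition is invariant under swapping the two points. $R^{d,t}_2(3;m)$ is the minimum integer $N$ such that for every $N$-element point set $P\subset\mathbb{R}^d$ equipped with symmetric binary semi-algebraic relations $E_1,\dots,E_m\subset\binom{P}{2}$, each of complexity at most $t$, with $\binom{P}{2}=E_1\cup\dots\cup E_m$, there are three points of $P$ and an index $i$ such that all three pairs among them lie in $E_i$. *)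

theory Defs
  imports "HOL-Analysis.Analysis" "HOL-Library.Poly_Mapping" "HOL-Library.Ramsey"
    "HOL-Library.Extended_Nat" "HOL-Library.Extended_Real"
begin

text \<open>
  A multivariate real polynomial is a finitely supported map from exponent vectors
  to coefficients. A polynomial in the \<open>2d\<close> coordinates of a pair of points of
  \<open>real ^ 'd\<close> has its variables indexed by \<open>'d + 'd\<close>: the left summand for the
  coordinates of the first point, the right summand for those of the second.
\<close>

type_synonym 'v real_mpoly = "('v \<Rightarrow>\<^sub>0 nat) \<Rightarrow>\<^sub>0 real"

definition mpoly_eval :: "'v::finite real_mpoly \<Rightarrow> ('v \<Rightarrow> real) \<Rightarrow> real" where
  "mpoly_eval f a =
     (\<Sum>\<mu>\<in>Poly_Mapping.keys f. Poly_Mapping.lookup f \<mu> * (\<Prod>v\<in>UNIV. a v ^ Poly_Mapping.lookup \<mu> v))"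

text \<open>Total degree; the zero polynomial gets degree 0.\<close>

definition mpoly_total_degree :: "'v::finite real_mpoly \<Rightarrow> nat" where
  "mpoly_total_degree f =
     Max (insert 0 ((\<lambda>\<mu>. \<Sum>v\<in>UNIV. Poly_Mapping.lookup \<mu> v) ` Poly_Mapping.keys f))"

definition semialg_condition ::
  "('d::finite + 'd) real_mpoly list \<Rightarrow> (bool list \<Rightarrow> bool) \<Rightarrow> real ^ 'd \<Rightarrow> real ^ 'd \<Rightarrow> bool" where
  "semialg_condition fs \<Phi> x y \<longleftrightarrow>
     \<Phi> (map (\<lambda>f. mpoly_eval f (case_sum (\<lambda>k. x $ k) (\<lambda>k. y $ k)) \<ge> 0) fs)"

text \<open>
  The points are enumerated as \<open>p 1, \<dots>, p N\<close>, and a relation is a set of two-element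
  subsets of the point set. Symmetry refers to the condition defined by the same
  polynomials and Boolean function that describe the relation.
\<close>

definition semialg_description ::
  "nat \<Rightarrow> ('d::finite + 'd) real_mpoly list \<Rightarrow> (bool list \<Rightarrow> bool)
    \<Rightarrow> nat \<Rightarrow> (nat \<Rightarrow> real ^ 'd) \<Rightarrow> (real ^ 'd) set set \<Rightarrow> bool" where
  "semialg_description t fs \<Phi> N p E \<longleftrightarrow>
     length fs = t \<and> (\<forall>f\<in>set fs. mpoly_total_degree f \<le> t) \<and>
     (\<forall>i\<in>{1..N}. \<forall>j\<in>{1..N}. i < j \<longrightarrow> ({p i, p j} \<in> E \<longleftrightarrow> semialg_condition fs \<Phi> (p i) (p j)))"

definition symmetric_semialg_relation ::
  "nat \<Rightarrow> nat \<Rightarrow> (nat \<Rightarrow> real ^ 'd::finite) \<Rightarrow> (real ^ 'd) set set \<Rightarrow> bool" where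
  "symmetric_semialg_relation t N p E \<longleftrightarrow>
     E \<subseteq> nsets (p ` {1..N}) 2 \<and>
     (\<exists>fs \<Phi>. semialg_description t fs \<Phi> N p E \<and>
        (\<forall>i\<in>{1..N}. \<forall>j\<in>{1..N}. i \<noteq> j \<longrightarrow>
           (semialg_condition fs \<Phi> (p i) (p j) \<longleftrightarrow> semialg_condition fs \<Phi> (p j) (p i))))"

definition semialg_triangle_property :: "'d::finite itself \<Rightarrow> nat \<Rightarrow> nat \<Rightarrow> nat \<Rightarrow> bool" where
  "semialg_triangle_property _ t m N \<longleftrightarrow>
     (\<forall>(p :: nat \<Rightarrow> real ^ 'd) E.
        inj_on p {1..N} \<longrightarrow>
        (\<forall>i\<in>{1..m}. symmetric_semialg_relation t N p (E i)) \<longrightarrow>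
        nsets (p ` {1..N}) 2 = (\<Union>i\<in>{1..m}. E i) \<longrightarrow>
        (\<exists>T\<in>nsets (p ` {1..N}) 3. \<exists>i\<in>{1..m}. nsets T 2 \<subseteq> E i))"

text \<open>
  The multicolour Ramsey number for triangles and points in dimension \<open>d = CARD('d)\<close>.
  The infimum in \<open>enat\<close> is the minimum if some \<open>N\<close> has the property, and \<open>\<infinity>\<close> otherwise.
\<close>

definition semialg_ramsey :: "'d::finite itself \<Rightarrow> nat \<Rightarrow> nat \<Rightarrow> enat" where
  "semialg_ramsey TYPE('d) t m = Inf (enat ` {N. semialg_triangle_property TYPE('d) t m N})"

end

theory Submission
  imports Defs "HOL-Real_Asymp.Real_Asymp"
begin

text \<open>
  A polynomial condition on a pair is linear in the monomials of the second point, so the sign patterns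
  of \<open>M\<close> such conditions form a set system of bounded VC dimension and there are only polynomially many
  of them (Sauer--Shelah). A hitting set argument then yields a packing bound: some point \<open>x\<close> has a
  class \<open>W\<close> of at least \<open>card V / m ^ c\<close> points that only a \<open>1 / (16 m)\<close> fraction of all points
  distinguish from \<open>x\<close>. Half of the points \<open>p\<close> are then joined to almost all of \<open>W\<close> in a single colour
  \<open>clr p\<close>. If fewer than about \<open>log m\<close> colours \<open>clr p\<close> occur, a class of \<open>clr\<close> has one colour less and
  the loss is a factor \<open>O(log m)\<close>. Otherwise half of \<open>W\<close> avoids \<open>log m\<close> colours, at the cost of
  a factor \<open>m ^ c\<close>, which is bounded per colour. Hence \<open>card V\<close> is at most \<open>O(log m) ^ m\<close> up to a
  polynomial factor.
\<close>

section \<open>Shattering and the Sauer--Shelah bound\<close>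

definition shattered :: "'a set set \<Rightarrow> 'a set \<Rightarrow> bool" where
  "shattered F X \<longleftrightarrow> (\<forall>Y\<subseteq>X. \<exists>A\<in>F. A \<inter> X = Y)"

lemma shattered_mono: "shattered F X \<Longrightarrow> (\<And>A. A \<in> F \<Longrightarrow> \<exists>A'\<in>G. A' \<inter> X = A \<inter> X) \<Longrightarrow> shattered G X"
  unfolding shattered_def by metis

text \<open>Pajor's form of the Sauer--Shelah lemma. Split \<open>F\<close> at a point
  \<open>j\<close>: \<open>F0\<close> has the members avoiding \<open>j\<close>, \<open>F1\<close>
  the others with \<open>j\<close> deleted. A set shattered by both stays shattered by
  \<open>F\<close> after \<open>j\<close> is added.\<close>

lemma card_le_card_shattered:
  assumes "finite J" "F \<subseteq> Pow J"
  shows "card F \<le> card {X. X \<subseteq> J \<and> shattered F X}"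
  using assms
proof (induction J arbitrary: F rule: finite_induct)
  case empty
  show ?case
  proof (cases "F = {}")
    case False
    with empty have "F = {{}}" by auto
    then have "{X. X \<subseteq> {} \<and> shattered F X} = {{}}"
      by (auto simp: shattered_def)
    with \<open>F = {{}}\<close> show ?thesis by simp
  qed simp
next
  case (insert j J)
  define F0 where "F0 = {A \<in> F. j \<notin> A}"
  define F1 where "F1 = (\<lambda>A. A - {j}) ` {A \<in> F. j \<in> A}"
  let ?sh = "\<lambda>G. {X. X \<subseteq> J \<and> shattered G X}"
  have fin: "finite F" using insert.prems insert.hyps(1)
    by (meson finite.insertI finite_Pow_iff finite_subset)
  have sub: "F0 \<subseteq> Pow J" "F1 \<subseteq> Pow J" using insert.prems by (auto simp: F0_def F1_def)
  have finsh: "finite (?sh G)" for G using insert.hyps(1) by auto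
  have "card F1 = card {A \<in> F. j \<in> A}"
    unfolding F1_def by (rule card_image) (auto simp: inj_on_def)
  moreover have "card F = card F0 + card {A \<in> F. j \<in> A}"
    unfolding F0_def using fin by (subst card_Un_disjoint[symmetric]) (auto intro!: arg_cong[where f = card])
  ultimately have "card F = card F0 + card F1" by simp
  also have "\<dots> \<le> card (?sh F0) + card (?sh F1)"
    using insert.IH sub by (intro add_mono) auto
  also have "\<dots> = card (?sh F0 \<union> ?sh F1) + card (?sh F0 \<inter> ?sh F1)"
    by (rule card_Un_Int) (rule finsh)+
  \<comment> \<open>Sets counted twice are replaced by their copies with \<open>j\<close> added,
    which are new because \<open>j \<notin> J\<close>.\<close>
  also have "card (?sh F0 \<inter> ?sh F1) = card (insert j ` (?sh F0 \<inter> ?sh F1))"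
    using insert.hyps(2) by (intro card_image[symmetric]) (auto simp: inj_on_def)
  also have "card (?sh F0 \<union> ?sh F1) + \<dots> = card ((?sh F0 \<union> ?sh F1) \<union> insert j ` (?sh F0 \<inter> ?sh F1))"
    using insert.hyps finsh by (intro card_Un_disjoint[symmetric]) auto
  also have "\<dots> \<le> card {X. X \<subseteq> insert j J \<and> shattered F X}"
  proof (rule card_mono)
    show "finite {X. X \<subseteq> insert j J \<and> shattered F X}" using insert.hyps(1) by auto
    have "shattered F X" if "X \<subseteq> J" "shattered F0 X" for X
      using that(2) by (rule shattered_mono) (auto simp: F0_def)
    moreover have "shattered F X" if "X \<subseteq> J" "shattered F1 X" for X
      using that(2) by (rule shattered_mono) (use that(1) insert.hyps(2) in \<open>auto simp: F1_def\<close>)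
    moreover have "shattered F (insert j X)" if XJ: "X \<subseteq> J" and X0: "shattered F0 X" and X1: "shattered F1 X" for X
      unfolding shattered_def
    proof (intro allI impI)
      fix Y assume Y: "Y \<subseteq> insert j X"
      have jX: "j \<notin> X" using XJ insert.hyps by auto
      show "\<exists>A\<in>F. A \<inter> insert j X = Y"
      proof (cases "j \<in> Y")
        case True
        obtain A where "A \<in> F1" "A \<inter> X = Y - {j}"
          using X1 Y unfolding shattered_def by (metis Diff_subset_conv insert_is_Un)
        then obtain A' where "A' \<in> F" "j \<in> A'" "(A' - {j}) \<inter> X = Y - {j}" by (auto simp: F1_def)
        then show ?thesis using True jX by (intro bexI[of _ A']) auto
      next
        case False
        then have "Y \<subseteq> X" using Y by auto
        then obtain A where "A \<in> F0" "A \<inter> X = Y"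
          using X0 unfolding shattered_def by blast
        then show ?thesis by (auto simp: F0_def)
      qed
    qed
    ultimately show "(?sh F0 \<union> ?sh F1) \<union> insert j ` (?sh F0 \<inter> ?sh F1) \<subseteq> {X. X \<subseteq> insert j J \<and> shattered F X}"
      by auto
  qed
  finally show ?case .
qed

text \<open>Termwise comparison with the expansion of \<open>(card J + 1) ^ k\<close>, whose
  coefficients \<open>k choose i\<close> are at least 1.\<close>

lemma card_bounded_subsets_le:
  assumes "finite J"
  shows "card {X. X \<subseteq> J \<and> card X \<le> k} \<le> (card J + 1) ^ k"
proof -
  have "{X. X \<subseteq> J \<and> card X \<le> k} = (\<Union>i\<le>k. {X. X \<subseteq> J \<and> card X = i})" by auto
  then have "card {X. X \<subseteq> J \<and> card X \<le> k} \<le> (\<Sum>i\<le>k. card {X. X \<subseteq> J \<and> card X = i})"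
    by (simp add: card_UN_le)
  also have "\<dots> = (\<Sum>i\<le>k. card J choose i)" using n_subsets[OF assms] by simp
  also have "\<dots> \<le> (\<Sum>i\<le>k. (k choose i) * card J ^ i)"
  proof (rule sum_mono)
    fix i assume "i \<in> {..k}"
    then have "1 \<le> k choose i" by (simp add: Suc_leI)
    moreover have "card J choose i \<le> card J ^ i"
      by (cases "i \<le> card J") (auto intro: binomial_le_pow simp: binomial_eq_0)
    ultimately show "card J choose i \<le> (k choose i) * card J ^ i"
      by (metis mult.left_neutral mult_le_mono)
  qed
  also have "\<dots> = (card J + 1) ^ k"
    using binomial[of "card J" 1 k] by simp
  finally show ?thesis .
qed

section \<open>Sign patterns of linear forms\<close>

lemma exists_linear_dependence:
  fixes a :: "'j \<Rightarrow> 'i \<Rightarrow> real"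
  assumes "finite I" "finite J" "card I < card J"
  shows "\<exists>c. (\<exists>j\<in>J. c j \<noteq> 0) \<and> (\<forall>i\<in>I. (\<Sum>j\<in>J. c j * a j i) = 0)"
  using assms
proof (induction I arbitrary: J a rule: finite_induct)
  case empty
  then obtain j where "j \<in> J" by (metis card.empty less_irrefl ex_in_conv)
  then show ?case by (intro exI[of _ "\<lambda>_. 1"]) auto
next
  case (insert i I)
  show ?case
  proof (cases "\<forall>j\<in>J. a j i = 0")
    case True
    have "card I < card J" using insert by simp
    then show ?thesis using insert.IH[OF insert.prems(1), of a] True by auto
  next
    case False
    then obtain j0 where j0: "j0 \<in> J" "a j0 i \<noteq> 0" by auto
    \<comment> \<open>Gaussian elimination: subtracting multiples of the pivot vector
      \<open>a j0\<close> makes coordinate \<open>i\<close> vanish, and \<open>c0\<close> is the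
      value that equation \<open>i\<close> then forces on the pivot.\<close>
    let ?J = "J - {j0}"
    have "card I < card ?J" using insert j0 by simp
    then obtain c where c: "\<exists>j\<in>?J. c j \<noteq> 0"
      "\<And>k. k \<in> I \<Longrightarrow> (\<Sum>j\<in>?J. c j * (a j k - a j i / a j0 i * a j0 k)) = 0"
      using insert.IH[of ?J "\<lambda>j k. a j k - a j i / a j0 i * a j0 k"] insert.prems(1) by auto
    define c0 where "c0 = - (\<Sum>j\<in>?J. c j * a j i) / a j0 i"
    define c' where "c' = c(j0 := c0)"
    have split: "(\<Sum>j\<in>J. c' j * a j k) = c0 * a j0 k + (\<Sum>j\<in>?J. c j * a j k)" for k
      using insert.prems(1) j0(1)
      by (subst sum.remove[of _ j0]) (auto simp: c'_def intro!: sum.cong)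
    have "(\<Sum>j\<in>J. c' j * a j k) = 0" if "k \<in> insert i I" for k
    proof (cases "k = i")
      case True
      then show ?thesis using j0 by (simp add: split c0_def)
    next
      case False
      have "(\<Sum>j\<in>?J. c j * a j k) = (\<Sum>j\<in>?J. c j * a j i) / a j0 i * a j0 k"
        using c(2)[of k] that False
        by (simp add: right_diff_distrib sum_subtractf sum_divide_distrib sum_distrib_right mult.assoc)
      then show ?thesis by (simp add: split c0_def)
    qed
    moreover have "\<exists>j\<in>J. c' j \<noteq> 0" using c(1) by (auto simp: c'_def)
    ultimately show ?thesis by blast
  qed
qed

text \<open>If \<open>X\<close> were larger, its coefficient vectors would satisfy a linear
  dependence \<open>c\<close>. Shattering gives an \<open>x\<close> whose forms are nonnegative
  exactly where \<open>c\<close> is, so the sum of \<open>c j\<close> times form \<open>j\<close> is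
  positive; yet the dependence makes it 0.\<close>

lemma card_shattered_halfspaces_le:
  fixes a :: "'j \<Rightarrow> 'i \<Rightarrow> real"
  assumes "finite I" "finite J" "X \<subseteq> J"
    and sh: "shattered ((\<lambda>x. {j \<in> J. 0 \<le> (\<Sum>i\<in>I. a j i * \<phi> x i)}) ` U) X"
  shows "card X \<le> card I"
proof (rule ccontr)
  assume "\<not> card X \<le> card I"
  moreover have finX: "finite X" using assms finite_subset by blast
  ultimately obtain c0 where c0: "\<exists>j\<in>X. c0 j \<noteq> 0" "\<forall>i\<in>I. (\<Sum>j\<in>X. c0 j * a j i) = 0"
    using exists_linear_dependence[OF assms(1), of X a] by force
  \<comment> \<open>Strict positivity needs a negative coefficient: where \<open>c j < 0\<close> the
    form is strictly negative, whereas \<open>c j > 0\<close> allows the form to be 0. A change of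
    sign provides one.\<close>
  have "\<exists>c. (\<exists>j\<in>X. c j < 0) \<and> (\<forall>i\<in>I. (\<Sum>j\<in>X. c j * a j i) = 0)"
  proof (cases "\<exists>j\<in>X. c0 j < 0")
    case True
    then show ?thesis using c0 by blast
  next
    case False
    then show ?thesis using c0
      by (intro exI[of _ "\<lambda>j. - c0 j"]) (auto simp: sum_negf less_eq_real_def not_less)
  qed
  then obtain c where c: "\<exists>j\<in>X. c j < 0" "\<And>i. i \<in> I \<Longrightarrow> (\<Sum>j\<in>X. c j * a j i) = 0" by blast
  have "{j \<in> X. 0 \<le> c j} \<subseteq> X" by auto
  then obtain x where x: "{j \<in> J. 0 \<le> (\<Sum>i\<in>I. a j i * \<phi> x i)} \<inter> X = {j \<in> X. 0 \<le> c j}"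
    using sh unfolding shattered_def by blast
  then have sgn: "0 \<le> (\<Sum>i\<in>I. a j i * \<phi> x i) \<longleftrightarrow> 0 \<le> c j" if "j \<in> X" for j
    using that assms(3) by blast
  have "0 < (\<Sum>j\<in>X. c j * (\<Sum>i\<in>I. a j i * \<phi> x i))"
  proof -
    obtain j where j: "j \<in> X" "c j < 0" using c by auto
    have "0 \<le> c k * (\<Sum>i\<in>I. a k i * \<phi> x i)" if "k \<in> X" for k
      using sgn[OF that] by (metis linear mult_nonneg_nonneg mult_nonpos_nonpos)
    moreover have "0 < c j * (\<Sum>i\<in>I. a j i * \<phi> x i)"
      using sgn[OF j(1)] j(2) by (intro mult_neg_neg) auto
    ultimately show ?thesis using finX j(1) by (intro sum_pos2) auto
  qed
  also have "(\<Sum>j\<in>X. c j * (\<Sum>i\<in>I. a j i * \<phi> x i)) = (\<Sum>j\<in>X. \<Sum>i\<in>I. c j * a j i * \<phi> x i)"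
    by (simp add: sum_distrib_left mult.assoc)
  also have "\<dots> = (\<Sum>i\<in>I. (\<Sum>j\<in>X. c j * a j i) * \<phi> x i)"
    by (subst sum.swap) (simp add: sum_distrib_right)
  also have "\<dots> = 0" using c(2) by simp
  finally show False by simp
qed

lemma card_sign_patterns_le:
  fixes a :: "'j \<Rightarrow> 'i \<Rightarrow> real"
  assumes "finite I" "finite J"
  shows "card ((\<lambda>x. {j \<in> J. 0 \<le> (\<Sum>i\<in>I. a j i * \<phi> x i)}) ` U) \<le> (card J + 1) ^ card I"
proof -
  let ?F = "(\<lambda>x. {j \<in> J. 0 \<le> (\<Sum>i\<in>I. a j i * \<phi> x i)}) ` U"
  have "card ?F \<le> card {X. X \<subseteq> J \<and> shattered ?F X}"
    using assms by (intro card_le_card_shattered) auto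
  also have "\<dots> \<le> card {X. X \<subseteq> J \<and> card X \<le> card I}"
    using card_shattered_halfspaces_le[OF assms] assms(2) by (intro card_mono) auto
  also have "\<dots> \<le> (card J + 1) ^ card I" by (rule card_bounded_subsets_le[OF assms(2)])
  finally show ?thesis .
qed

section \<open>Polynomial conditions as linear conditions on monomials\<close>

definition exponents_upto :: "nat \<Rightarrow> ('d::finite \<Rightarrow> nat) set" where
  "exponents_upto t = Pi\<^sub>E UNIV (\<lambda>_. {..t})"

lemma finite_exponents_upto: "finite (exponents_upto t)"
  by (simp add: exponents_upto_def finite_PiE)

text \<open>The coefficient of the monomial with exponents \<open>\<nu>\<close> when
  \<open>f\<close> is read as a polynomial in the second point, evaluated at the first point
  \<open>x\<close>.\<close>

definition partial_coeff :: "('d::finite + 'd) real_mpoly \<Rightarrow> ('d \<Rightarrow> real) \<Rightarrow> ('d \<Rightarrow> nat) \<Rightarrow> real" where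
  "partial_coeff f x \<nu> =
     (\<Sum>\<mu> | \<mu> \<in> Poly_Mapping.keys f \<and> (\<lambda>k. Poly_Mapping.lookup \<mu> (Inr k)) = \<nu>.
        Poly_Mapping.lookup f \<mu> * (\<Prod>k\<in>UNIV. x k ^ Poly_Mapping.lookup \<mu> (Inl k)))"

text \<open>Monomials of \<open>f\<close> are grouped by their exponents in the second point. The
  box \<open>exponents_upto t\<close> contains all that occur, and its size depends only on
  \<open>t\<close> and the dimension.\<close>

lemma mpoly_eval_case_sum:
  assumes "mpoly_total_degree f \<le> t"
  shows "mpoly_eval f (case_sum x y)
    = (\<Sum>\<nu>\<in>exponents_upto t. partial_coeff f x \<nu> * (\<Prod>k\<in>UNIV. y k ^ \<nu> k))"
proof -
  let ?l = "Poly_Mapping.lookup" and ?K = "Poly_Mapping.keys f"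
  let ?r = "\<lambda>\<mu> k. ?l \<mu> (Inr k)"
  have deg: "?r \<mu> \<in> exponents_upto t" if "\<mu> \<in> ?K" for \<mu>
  proof -
    have "?l \<mu> (Inr k) \<le> t" for k
    proof -
      have "?l \<mu> (Inr k) \<le> (\<Sum>v\<in>UNIV. ?l \<mu> v)"
        by (rule member_le_sum) auto
      also have "\<dots> \<le> mpoly_total_degree f"
        unfolding mpoly_total_degree_def using that by (intro Max_ge) auto
      finally show ?thesis using assms by simp
    qed
    then show ?thesis by (auto simp: exponents_upto_def PiE_def extensional_def)
  qed
  have prod: "(\<Prod>v\<in>UNIV. case_sum x y v ^ ?l \<mu> v)
      = (\<Prod>k\<in>UNIV. x k ^ ?l \<mu> (Inl k)) * (\<Prod>k\<in>UNIV. y k ^ ?r \<mu> k)" for \<mu> :: "'a + 'a \<Rightarrow>\<^sub>0 nat"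
    by (subst UNIV_Plus_UNIV[symmetric], subst prod.Plus) auto
  have "mpoly_eval f (case_sum x y) = (\<Sum>\<mu>\<in>?K. ?l f \<mu> * (\<Prod>k\<in>UNIV. x k ^ ?l \<mu> (Inl k)) * (\<Prod>k\<in>UNIV. y k ^ ?r \<mu> k))"
    by (simp add: mpoly_eval_def prod mult.assoc)
  also have "\<dots> = (\<Sum>\<nu>\<in>exponents_upto t. \<Sum>\<mu> | \<mu> \<in> ?K \<and> ?r \<mu> = \<nu>.
       ?l f \<mu> * (\<Prod>k\<in>UNIV. x k ^ ?l \<mu> (Inl k)) * (\<Prod>k\<in>UNIV. y k ^ ?r \<mu> k))"
    using deg by (intro sum.group[symmetric] finite_exponents_upto) auto
  also have "\<dots> = (\<Sum>\<nu>\<in>exponents_upto t. partial_coeff f x \<nu> * (\<Prod>k\<in>UNIV. y k ^ \<nu> k))"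
    unfolding partial_coeff_def by (intro sum.cong refl) (auto simp: sum_distrib_right intro!: sum.cong)
  finally show ?thesis .
qed

definition cond_colours ::
  "nat \<Rightarrow> (nat \<Rightarrow> ('d::finite + 'd) real_mpoly list) \<Rightarrow> (nat \<Rightarrow> bool list \<Rightarrow> bool)
    \<Rightarrow> real ^ 'd \<Rightarrow> real ^ 'd \<Rightarrow> nat set" where
  "cond_colours m fs \<Phi> x y = {i \<in> {1..m}. semialg_condition (fs i) (\<Phi> i) x y}"

text \<open>With the first point ranging over \<open>S\<close>, the \<open>t\<close> polynomials of
  each of the \<open>m\<close> colours give \<open>m * t * card S\<close> linear forms in the
  monomials of \<open>x\<close>. Their signs determine the colour sets through the Boolean
  functions, so colour patterns are no more numerous than sign patterns.\<close>

lemma card_colour_patterns_le: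
  fixes fs :: "nat \<Rightarrow> ('d::finite + 'd) real_mpoly list" and S U :: "(real ^ 'd) set"
  assumes fs: "\<And>i. i \<in> {1..m} \<Longrightarrow> length (fs i) = t"
    "\<And>i f. i \<in> {1..m} \<Longrightarrow> f \<in> set (fs i) \<Longrightarrow> mpoly_total_degree f \<le> t"
    and "finite S" "finite U"
  shows "card ((\<lambda>x. restrict (\<lambda>p. cond_colours m fs \<Phi> p x) S) ` U)
    \<le> (m * t * card S + 1) ^ card (exponents_upto t :: ('d \<Rightarrow> nat) set)"
proof -
  let ?I = "exponents_upto t :: ('d \<Rightarrow> nat) set"
  let ?J = "S \<times> {1..m} \<times> {..<t}"
  define a where "a = (\<lambda>(p :: real ^ 'd, i, l). partial_coeff (fs i ! l) (\<lambda>k. p $ k))"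
  define \<phi> where "\<phi> = (\<lambda>(x :: real ^ 'd) \<nu>. \<Prod>k\<in>UNIV. x $ k ^ \<nu> k)"
  define A where "A = (\<lambda>x. {j \<in> ?J. 0 \<le> (\<Sum>\<nu>\<in>?I. a j \<nu> * \<phi> x \<nu>)})"
  define h where "h = (\<lambda>X. restrict (\<lambda>p. {i \<in> {1..m}. \<Phi> i (map (\<lambda>l. (p, i, l) \<in> X) [0..<t])}) S)"
  have "restrict (\<lambda>p. cond_colours m fs \<Phi> p x) S = h (A x)" for x
  proof -
    have "semialg_condition (fs i) (\<Phi> i) p x \<longleftrightarrow> \<Phi> i (map (\<lambda>l. (p, i, l) \<in> A x) [0..<t])"
      if "p \<in> S" "i \<in> {1..m}" for p i
    proof -
      have "map (\<lambda>f. mpoly_eval f (case_sum (\<lambda>k. p $ k) (\<lambda>k. x $ k)) \<ge> 0) (fs i)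
          = map (\<lambda>l. (p, i, l) \<in> A x) [0..<t]"
      proof (rule nth_equalityI)
        fix l assume "l < length (map (\<lambda>f. mpoly_eval f (case_sum (\<lambda>k. p $ k) (\<lambda>k. x $ k)) \<ge> 0) (fs i))"
        then have l: "l < t" using fs that by simp
        then have "mpoly_total_degree (fs i ! l) \<le> t" using fs that by simp
        from mpoly_eval_case_sum[OF this]
        show "map (\<lambda>f. mpoly_eval f (case_sum (\<lambda>k. p $ k) (\<lambda>k. x $ k)) \<ge> 0) (fs i) ! l
          = map (\<lambda>l. (p, i, l) \<in> A x) [0..<t] ! l"
          using l that fs by (simp add: A_def a_def \<phi>_def)
      qed (use fs that in simp)
      then show ?thesis by (simp add: semialg_condition_def)
    qed
    then show ?thesis unfolding h_def cond_colours_def by (intro restrict_ext) blast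
  qed
  then have "(\<lambda>x. restrict (\<lambda>p. cond_colours m fs \<Phi> p x) S) ` U = h ` (A ` U)"
    by (simp add: image_image)
  then have "card ((\<lambda>x. restrict (\<lambda>p. cond_colours m fs \<Phi> p x) S) ` U) \<le> card (A ` U)"
    using card_image_le[of "A ` U" h] assms(4) by simp
  also have "\<dots> \<le> (card ?J + 1) ^ card ?I"
    unfolding A_def by (rule card_sign_patterns_le) (use assms(3) finite_exponents_upto in auto)
  also have "card ?J = m * t * card S" by (simp add: card_cartesian_product)
  finally show ?thesis .
qed

section \<open>Hitting sets and packing\<close>

text \<open>Greedy choice: by double counting, some point lies in at least an
  \<open>\<epsilon>\<close> fraction of the sets not yet hit, so each new point multiplies their
  number by at most \<open>1 - \<epsilon>\<close>.\<close>

lemma exists_small_hitting_set: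
  fixes D :: "'r \<Rightarrow> 'a set" and \<epsilon> :: real
  assumes "finite V" "V \<noteq> {}" "finite R" "0 \<le> \<epsilon>" "\<epsilon> \<le> 1"
    and D: "\<And>r. r \<in> R \<Longrightarrow> D r \<subseteq> V \<and> \<epsilon> * card V \<le> card (D r)"
  shows "\<exists>S\<subseteq>V. card S \<le> s \<and> real (card {r \<in> R. D r \<inter> S = {}}) \<le> (1 - \<epsilon>) ^ s * card R"
proof (induction s)
  case 0
  show ?case by (intro exI[of _ "{}"]) auto
next
  case (Suc s)
  then obtain S where S: "S \<subseteq> V" "card S \<le> s"
    "real (card {r \<in> R. D r \<inter> S = {}}) \<le> (1 - \<epsilon>) ^ s * card R" by blast
  define R' where "R' = {r \<in> R. D r \<inter> S = {}}"
  have finR': "finite R'" using assms(3) by (simp add: R'_def)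
  have "\<exists>p\<in>V. \<epsilon> * card R' \<le> card {r \<in> R'. p \<in> D r}"
  proof (rule ccontr)
    assume "\<not> ?thesis"
    then have "(\<Sum>p\<in>V. real (card {r \<in> R'. p \<in> D r})) < (\<Sum>p\<in>V. \<epsilon> * card R')"
      using assms(1,2) by (intro sum_strict_mono) auto
    also have "\<dots> = (\<Sum>r\<in>R'. \<epsilon> * card V)" by simp
    also have "\<dots> \<le> (\<Sum>r\<in>R'. real (card (D r)))"
      using D by (intro sum_mono) (auto simp: R'_def)
    also have "\<dots> = (\<Sum>r\<in>R'. real (card {p \<in> V. p \<in> D r}))"
      using D by (intro sum.cong refl arg_cong[where f = "\<lambda>X. real (card X)"]) (auto simp: R'_def)
    also have "\<dots> = (\<Sum>p\<in>V. real (card {r \<in> R'. p \<in> D r}))"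
      using sum.swap_restrict[OF assms(1) finR', of "\<lambda>_ _. 1 :: real" "\<lambda>p r. p \<in> D r"] by simp
    finally show False by simp
  qed
  then obtain p where p: "p \<in> V" "\<epsilon> * card R' \<le> card {r \<in> R'. p \<in> D r}" by blast
  have "{r \<in> R. D r \<inter> insert p S = {}} = R' - {r \<in> R'. p \<in> D r}" by (auto simp: R'_def)
  then have "real (card {r \<in> R. D r \<inter> insert p S = {}}) = real (card R') - card {r \<in> R'. p \<in> D r}"
    using finR' by (simp add: card_Diff_subset card_mono of_nat_diff)
  also have "\<dots> \<le> (1 - \<epsilon>) * card R'" using p(2) by (simp add: algebra_simps)
  also have "\<dots> \<le> (1 - \<epsilon>) * ((1 - \<epsilon>) ^ s * card R)"
    using S(3) assms(5) by (intro mult_left_mono) (auto simp: R'_def)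
  finally have "real (card {r \<in> R. D r \<inter> insert p S = {}}) \<le> (1 - \<epsilon>) ^ Suc s * card R" by simp
  moreover have "card (insert p S) \<le> Suc s"
    using S(2) by (metis card_insert_le_m1 Suc_leI card_insert_if finite_subset[OF S(1) assms(1)] le_SucI Suc_le_mono)
  ultimately show ?case using p(1) S(1) by (intro exI[of _ "insert p S"]) auto
qed

text \<open>For each ordered pair of distinct points of \<open>F\<close>, the set of points
  distinguishing them is to be hit. Fewer than one such set is left unhit, hence none.\<close>

lemma exists_separating_set:
  fixes g :: "'a \<Rightarrow> 'b \<Rightarrow> 'c" and \<epsilon> :: real
  assumes "finite V" "V \<noteq> {}" "finite F" "0 \<le> \<epsilon>" "\<epsilon> \<le> 1"
    and far: "\<And>x y. x \<in> F \<Longrightarrow> y \<in> F \<Longrightarrow> x \<noteq> y \<Longrightarrow> \<epsilon> * card V \<le> card {p \<in> V. g p x \<noteq> g p y}"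
    and s: "real (card F) ^ 2 * (1 - \<epsilon>) ^ s < 1"
  shows "\<exists>S\<subseteq>V. card S \<le> s \<and> inj_on (\<lambda>x. restrict (\<lambda>p. g p x) S) F"
proof -
  define R where "R = {(x, y) \<in> F \<times> F. x \<noteq> y}"
  define D where "D = (\<lambda>(x, y). {p \<in> V. g p x \<noteq> g p y})"
  have R: "R \<subseteq> F \<times> F" by (auto simp: R_def)
  then have finR: "finite R" using assms(3) finite_subset by blast
  obtain S where S: "S \<subseteq> V" "card S \<le> s" "real (card {r \<in> R. D r \<inter> S = {}}) \<le> (1 - \<epsilon>) ^ s * card R"
    using exists_small_hitting_set[OF assms(1,2) finR assms(4,5), of D s] far
    by (auto simp: R_def D_def)
  have "card R \<le> card F ^ 2"
    using card_mono[OF _ R] assms(3) by (simp add: card_cartesian_product power2_eq_square)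
  then have "real (card R) \<le> real (card F) ^ 2"
    by (metis of_nat_le_iff of_nat_power)
  then have "(1 - \<epsilon>) ^ s * card R \<le> (1 - \<epsilon>) ^ s * real (card F) ^ 2"
    using assms(5) by (intro mult_left_mono) auto
  then have "real (card {r \<in> R. D r \<inter> S = {}}) < 1" using S(3) s by (simp add: mult.commute)
  then have none: "{r \<in> R. D r \<inter> S = {}} = {}" using finR by simp
  have "inj_on (\<lambda>x. restrict (\<lambda>p. g p x) S) F"
  proof (rule inj_onI, rule ccontr)
    fix x y assume xy: "x \<in> F" "y \<in> F" "x \<noteq> y" "restrict (\<lambda>p. g p x) S = restrict (\<lambda>p. g p y) S"
    then have "(x, y) \<in> R" by (simp add: R_def)
    then obtain p where "p \<in> S" "g p x \<noteq> g p y" using none by (fastforce simp: D_def)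
    then show False using fun_cong[OF xy(4), of p] by simp
  qed
  with S show ?thesis by blast
qed

text \<open>A packing bound in the manner of Haussler. A maximal family of pairwise far points has
  fewer than \<open>k\<close> members, since a separating set of at most \<open>s\<close> points
  would give \<open>k\<close> of them distinct patterns. By maximality their close classes cover
  \<open>V\<close>; the largest one is taken.\<close>

lemma exists_large_close_class:
  fixes g :: "'a \<Rightarrow> 'a \<Rightarrow> 'c" and \<epsilon> :: real
  assumes "finite V" "V \<noteq> {}" "0 \<le> \<epsilon>" "\<epsilon> \<le> 1"
    and growth: "\<And>S. S \<subseteq> V \<Longrightarrow> card S \<le> s \<Longrightarrow> card ((\<lambda>x. restrict (\<lambda>p. g p x) S) ` V) < k"
    and s: "real k ^ 2 * (1 - \<epsilon>) ^ s < 1"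
  shows "\<exists>x\<in>V. card V \<le> k * card {y \<in> V. card {p \<in> V. g p x \<noteq> g p y} \<le> \<epsilon> * card V}"
proof -
  define far where "far F \<longleftrightarrow> F \<subseteq> V \<and> (\<forall>x\<in>F. \<forall>y\<in>F. x \<noteq> y \<longrightarrow> \<epsilon> * card V < card {p \<in> V. g p x \<noteq> g p y})" for F
  define W where "W x = {y \<in> V. card {p \<in> V. g p x \<noteq> g p y} \<le> \<epsilon> * card V}" for x
  have bound: "card F < k" if "far F" for F
  proof (rule ccontr)
    assume "\<not> card F < k"
    then obtain G where G: "G \<subseteq> F" "card G = k" "finite G"
      using obtain_subset_with_card_n[of k F] by (metis not_less)
    then have "far G" using that by (auto simp: far_def)
    have "\<exists>S\<subseteq>V. card S \<le> s \<and> inj_on (\<lambda>x. restrict (\<lambda>p. g p x) S) G"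
      using \<open>far G\<close> s G by (intro exists_separating_set[OF assms(1,2) _ assms(3,4)]) (auto simp: far_def less_imp_le)
    then obtain S where S: "S \<subseteq> V" "card S \<le> s" "inj_on (\<lambda>x. restrict (\<lambda>p. g p x) S) G" by blast
    have "k = card ((\<lambda>x. restrict (\<lambda>p. g p x) S) ` G)" using card_image[OF S(3)] G by simp
    also have "\<dots> \<le> card ((\<lambda>x. restrict (\<lambda>p. g p x) S) ` V)"
      using assms(1) \<open>far G\<close> by (intro card_mono image_mono) (auto simp: far_def)
    also have "\<dots> < k" using growth S by blast
    finally show False by simp
  qed
  have "finite {F. far F}" by (rule finite_subset[of _ "Pow V"]) (use assms(1) in \<open>auto simp: far_def\<close>)
  moreover have "far {}" by (simp add: far_def)
  ultimately obtain F where F: "far F" "\<And>G. far G \<Longrightarrow> F \<subseteq> G \<Longrightarrow> F = G"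
    using finite_has_maximal[of "{F. far F}"] by blast
  have FV: "F \<subseteq> V" "finite F" using F(1) assms(1) finite_subset by (auto simp: far_def)
  have cover: "V \<subseteq> (\<Union>x\<in>F. W x)"
  proof
    fix y assume y: "y \<in> V"
    show "y \<in> (\<Union>x\<in>F. W x)"
    proof (rule ccontr)
      assume *: "y \<notin> (\<Union>x\<in>F. W x)"
      have comm: "{p \<in> V. g p y \<noteq> g p x} = {p \<in> V. g p x \<noteq> g p y}" for x by auto
      have "far (insert y F)"
        using F(1) * y unfolding far_def W_def by (auto simp: comm not_le)
      then have "F = insert y F" using F(2) by blast
      then have "y \<in> F" by blast
      moreover have "y \<in> W y" using y assms(3) by (simp add: W_def)
      ultimately show False using * by blast
    qed
  qed
  have finW: "finite (W x)" for x using assms(1) by (simp add: W_def)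
  have "F \<noteq> {}" using cover assms(2) by auto
  then have "Max ((\<lambda>x. card (W x)) ` F) \<in> (\<lambda>x. card (W x)) ` F" using FV by (intro Max_in) auto
  then obtain x where x: "x \<in> F" "Max ((\<lambda>x. card (W x)) ` F) = card (W x)" by auto
  have "card V \<le> card (\<Union>x\<in>F. W x)" using cover FV finW by (intro card_mono) auto
  also have "\<dots> \<le> (\<Sum>x\<in>F. card (W x))" using FV by (intro card_UN_le)
  also have "\<dots> \<le> (\<Sum>z\<in>F. card (W x))"
    unfolding x(2)[symmetric] using FV by (intro sum_mono Max_ge) auto
  also have "\<dots> \<le> k * card (W x)" using bound[OF F(1)] by simp
  finally show ?thesis using x(1) FV unfolding W_def by blast
qed

section \<open>Close classes\<close>

text \<open>Closeness at scale \<open>1 / (16 * m)\<close>, cleared of denominators to stay in the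
  natural numbers.\<close>

definition close_class :: "('a \<Rightarrow> 'a \<Rightarrow> 'c) \<Rightarrow> nat \<Rightarrow> 'a set \<Rightarrow> 'a \<Rightarrow> 'a set" where
  "close_class g m U x = {y \<in> U. 16 * m * card {p \<in> U. g p x \<noteq> g p y} \<le> card U}"

text \<open>Markov's inequality after double counting the pairs of \<open>p\<close> and
  \<open>y\<close> with \<open>g p x \<noteq> g p y\<close>: each \<open>y\<close> in
  \<open>W\<close> accounts for at most \<open>card U / (16 * m)\<close> of them, so at most half of
  the \<open>p\<close> account for more than \<open>card W / (8 * m)\<close> each.\<close>

lemma mostly_constant_on_close_class:
  assumes "finite U" and W: "W = close_class g m U x"
  shows "card U \<le> 2 * card {p \<in> U. 8 * m * card {y \<in> W. g p x \<noteq> g p y} \<le> card W}"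
proof (cases "W = {}")
  case True
  then show ?thesis by simp
next
  case False
  have WU: "W \<subseteq> U" "finite W" using assms by (auto simp: close_class_def)
  define Z where "Z = {p \<in> U. card W < 8 * m * card {y \<in> W. g p x \<noteq> g p y}}"
  have Z: "finite Z" "Z \<subseteq> U" using assms by (auto simp: Z_def)
  have "2 * (card Z * card W) = 2 * (\<Sum>p\<in>Z. card W)" by simp
  also have "\<dots> \<le> 2 * (\<Sum>p\<in>Z. 8 * m * card {y \<in> W. g p x \<noteq> g p y})"
    by (intro mult_left_mono sum_mono) (auto simp: Z_def)
  also have "\<dots> \<le> 2 * (\<Sum>p\<in>U. 8 * m * card {y \<in> W. g p x \<noteq> g p y})"
    using assms Z by (intro mult_left_mono sum_mono2) auto
  also have "\<dots> = 16 * m * (\<Sum>p\<in>U. card {y \<in> W. g p x \<noteq> g p y})"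
    by (simp add: sum_distrib_left mult.assoc)
  also have "(\<Sum>p\<in>U. card {y \<in> W. g p x \<noteq> g p y}) = (\<Sum>y\<in>W. card {p \<in> U. g p x \<noteq> g p y})"
    using sum.swap_restrict[OF assms(1) WU(2), of "\<lambda>_ _. 1 :: nat" "\<lambda>p y. g p x \<noteq> g p y"] by simp
  also have "16 * m * \<dots> = (\<Sum>y\<in>W. 16 * m * card {p \<in> U. g p x \<noteq> g p y})"
    by (simp add: sum_distrib_left)
  also have "\<dots> \<le> (\<Sum>y\<in>W. card U)"
    by (rule sum_mono) (simp add: W close_class_def)
  finally have "(2 * card Z) * card W \<le> card U * card W" by (simp add: ac_simps)
  moreover have "0 < card W" using False WU by (simp add: card_gt_0_iff)
  ultimately have "2 * card Z \<le> card U" by simp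
  moreover have "{p \<in> U. 8 * m * card {y \<in> W. g p x \<noteq> g p y} \<le> card W} = U - Z"
    by (auto simp: Z_def)
  ultimately show ?thesis using Z by (simp add: card_Diff_subset)
qed

section \<open>Colourings without monochromatic triangles\<close>

text \<open>Pairs carry sets of colours because the relations may overlap. Colours outside
  \<open>K\<close> are tolerated, so that \<open>K\<close> can shrink in the recursion while
  \<open>col\<close> stays fixed.\<close>

definition edge_colouring :: "('a \<Rightarrow> 'a \<Rightarrow> 'c set) \<Rightarrow> 'c set \<Rightarrow> 'a set \<Rightarrow> bool" where
  "edge_colouring col K V \<longleftrightarrow> (\<forall>x\<in>V. \<forall>y\<in>V. x \<noteq> y \<longrightarrow> col x y = col y x \<and> col x y \<inter> K \<noteq> {})"

definition triangle_free :: "('a \<Rightarrow> 'a \<Rightarrow> 'c set) \<Rightarrow> 'c set \<Rightarrow> 'a set \<Rightarrow> bool" where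
  "triangle_free col K V \<longleftrightarrow> (\<forall>x\<in>V. \<forall>y\<in>V. \<forall>z\<in>V. x \<noteq> y \<longrightarrow> y \<noteq> z \<longrightarrow> x \<noteq> z \<longrightarrow>
     K \<inter> col x y \<inter> col y z \<inter> col x z = {})"

lemma edge_colouring_avoiding:
  assumes "edge_colouring col K V" "U \<subseteq> V"
    "\<And>x y i. x \<in> U \<Longrightarrow> y \<in> U \<Longrightarrow> x \<noteq> y \<Longrightarrow> i \<in> I \<Longrightarrow> i \<notin> col x y"
  shows "edge_colouring col (K - I) U"
  unfolding edge_colouring_def
proof (intro ballI impI)
  fix x y assume xy: "x \<in> U" "y \<in> U" "x \<noteq> y"
  then have "col x y = col y x \<and> col x y \<inter> K \<noteq> {}"
    using assms(1,2) unfolding edge_colouring_def by blast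
  moreover have "col x y \<inter> I = {}" using assms(3)[OF xy] by blast
  ultimately show "col x y = col y x \<and> col x y \<inter> (K - I) \<noteq> {}" by blast
qed

lemma triangle_free_mono:
  assumes "triangle_free col K V" "K' \<subseteq> K" "U \<subseteq> V"
  shows "triangle_free col K' U"
  unfolding triangle_free_def
proof (intro ballI impI)
  fix x y z assume "x \<in> U" "y \<in> U" "z \<in> U" "x \<noteq> y" "y \<noteq> z" "x \<noteq> z"
  then have "K \<inter> col x y \<inter> col y z \<inter> col x z = {}"
    using assms(1,3) unfolding triangle_free_def by (simp add: subset_eq)
  then show "K' \<inter> col x y \<inter> col y z \<inter> col x z = {}" using assms(2) by auto
qed

text \<open>
  \<open>I\<close> is the set of colours \<open>clr p\<close> joining a typical point \<open>p\<close> to almost all of \<open>W\<close>. If \<open>I\<close> is small,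
  one of the classes \<open>f i\<close> is large and loses colour \<open>i\<close>; if \<open>I\<close> is large, a large part \<open>W'\<close> of \<open>W\<close>
  loses all colours of \<open>I\<close> at once.
\<close>
lemma avoid_colours_step:
  fixes col :: "'a \<Rightarrow> 'a \<Rightarrow> 'c set"
  assumes "finite V" "finite K" and m: "card K \<le> m" "1 \<le> m"
    and edge: "edge_colouring col K V" and tf: "triangle_free col K V"
    and W: "W = close_class col m V x0" and x0: "x0 \<in> V"
    and large: "8 * m \<le> card W"
  obtains I where "I \<subseteq> K"
    "\<exists>f :: 'c \<Rightarrow> 'a set. card V \<le> 3 * (\<Sum>i\<in>I. card (f i)) \<and>
       (\<forall>i\<in>I. f i \<subseteq> V \<and> edge_colouring col (K - {i}) (f i))"
    "\<exists>W'\<subseteq>V. card W \<le> 2 * card W' \<and> edge_colouring col (K - I) W'"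
proof -
  have no_triangle: False
    if "x \<in> V" "y \<in> V" "z \<in> V" "i \<in> K" "x \<noteq> y" "y \<noteq> z" "x \<noteq> z"
      "i \<in> col x y" "i \<in> col y z" "i \<in> col x z" for x y z i
    using tf that unfolding triangle_free_def by (metis IntI empty_iff)
  have WV: "W \<subseteq> V" "finite W" using assms(1) by (auto simp: W close_class_def)
  have large': "8 \<le> card W" "8 \<le> card V"
    using large m(2) card_mono[OF assms(1) WV(1)] by linarith+
  define A where "A = {p \<in> V. 8 * m * card {y \<in> W. col p x0 \<noteq> col p y} \<le> card W}"
  \<comment> \<open>\<open>x0\<close> is removed because a colouring says nothing about
    \<open>col x0 x0\<close>; with at least 8 points this only worsens the factor 2 to 3.\<close>
  define V0 where "V0 = A - {x0}"
  have V0: "V0 \<subseteq> V" "finite V0" using assms(1) by (auto simp: V0_def A_def)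
  have "card V \<le> 2 * (card V0 + 1)"
    using mostly_constant_on_close_class[OF assms(1) W, folded A_def]
    unfolding V0_def by (simp add: card_Diff_singleton_if) linarith
  then have cardV0: "card V \<le> 3 * card V0" using large'(2) by presburger
  define clr where "clr p = (SOME i. i \<in> col p x0 \<inter> K)" for p
  have clr: "clr p \<in> col p x0 \<inter> K" if "p \<in> V0" for p
  proof -
    have "p \<in> V" "p \<noteq> x0" using that by (auto simp: V0_def A_def)
    then have "col p x0 \<inter> K \<noteq> {}" using edge x0 unfolding edge_colouring_def by blast
    then show ?thesis unfolding clr_def by (rule some_in_eq[THEN iffD2])
  qed
  \<comment> \<open>Counting \<open>p\<close> itself as missed keeps the remaining points of
    \<open>W\<close> distinct from \<open>p\<close>. The extra point is absorbed by
    \<open>8 * m \<le> card W\<close>, with \<open>4 * m\<close> in place of \<open>8 * m\<close> in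
    the bound.\<close>
  define miss where "miss p = {y \<in> W. y = p \<or> clr p \<notin> col p y}" for p
  have fmiss: "finite (miss p)" "miss p \<subseteq> W" for p using WV by (auto simp: miss_def)
  have miss: "4 * m * card (miss p) \<le> card W" if "p \<in> V0" for p
  proof -
    have "miss p \<subseteq> insert p {y \<in> W. col p x0 \<noteq> col p y}" using clr[OF that] by (auto simp: miss_def)
    then have "card (miss p) \<le> card (insert p {y \<in> W. col p x0 \<noteq> col p y})"
      using WV by (intro card_mono) auto
    also have "\<dots> \<le> Suc (card {y \<in> W. col p x0 \<noteq> col p y})" by (simp add: card_insert_if WV)
    finally have "8 * m * card (miss p) \<le> 8 * m * Suc (card {y \<in> W. col p x0 \<noteq> col p y})"
      by (rule mult_le_mono2)
    also have "\<dots> = 8 * m * card {y \<in> W. col p x0 \<noteq> col p y} + 8 * m" by simp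
    also have "\<dots> \<le> 2 * card W" using that large by (simp add: V0_def A_def)
    finally show ?thesis by simp
  qed
  define I where "I = clr ` V0"
  have IK: "I \<subseteq> K" using clr by (auto simp: I_def)
  then have finI: "finite I" using assms(2) finite_subset by blast
  define f where "f i = {p \<in> V0. clr p = i}" for i
  have "card V0 = (\<Sum>i\<in>I. card (f i))"
  proof -
    have "V0 = (\<Union>i\<in>I. f i)" by (auto simp: I_def f_def)
    then have "card V0 = card (\<Union>i\<in>I. f i)" by (rule arg_cong)
    also have "\<dots> = (\<Sum>i\<in>I. card (f i))"
      using finI V0(2) by (intro card_UN_disjoint) (auto simp: f_def)
    finally show ?thesis .
  qed
  \<comment> \<open>Two points of one class together miss at most half of \<open>W\<close>, so they
    have a common neighbour in colour \<open>i\<close>; an edge of colour \<open>i\<close> between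
    them would close a triangle.\<close>
  moreover have "edge_colouring col (K - {i}) (f i)" if i: "i \<in> I" for i
  proof (rule edge_colouring_avoiding[OF edge])
    show "f i \<subseteq> V" using V0 by (auto simp: f_def)
    fix p q i' assume p: "p \<in> f i" and q: "q \<in> f i" and "p \<noteq> q" "i' \<in> {i}"
    have "4 * m * card (miss p \<union> miss q) \<le> 4 * m * (card (miss p) + card (miss q))"
      by (rule mult_le_mono2[OF card_Un_le])
    also have "\<dots> \<le> 2 * card W" using miss[of p] miss[of q] p q by (simp add: f_def algebra_simps)
    finally have "4 * m * card (miss p \<union> miss q) \<le> 2 * card W" .
    moreover have "4 * 1 * card (miss p \<union> miss q) \<le> 4 * m * card (miss p \<union> miss q)"
      by (intro mult_le_mono m(2) order_refl)
    ultimately have "card (miss p \<union> miss q) < card W" using large' by linarith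
    then have "\<not> W \<subseteq> miss p \<union> miss q" using fmiss by (meson card_mono finite_UnI leD)
    then obtain y where y: "y \<in> W" "y \<notin> miss p" "y \<notin> miss q" by blast
    have "y \<in> V" "p \<in> V" "q \<in> V" using y WV p q V0 by (auto simp: f_def)
    moreover have "i \<in> col p y" "i \<in> col q y" "y \<noteq> p" "y \<noteq> q"
      using y p q by (simp_all add: miss_def f_def)
    ultimately have "i \<notin> col p q"
      using no_triangle[of p q y i] \<open>p \<noteq> q\<close> i IK by blast
    then show "i' \<notin> col p q" using \<open>i' \<in> {i}\<close> by simp
  qed
  moreover have "f i \<subseteq> V" for i using V0 by (auto simp: f_def)
  ultimately have P1: "\<exists>f :: 'c \<Rightarrow> 'a set. card V \<le> 3 * (\<Sum>i\<in>I. card (f i)) \<and>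
       (\<forall>i\<in>I. f i \<subseteq> V \<and> edge_colouring col (K - {i}) (f i))"
    using cardV0 by (intro exI[of _ f]) simp
  \<comment> \<open>One representative \<open>r i\<close> per colour suffices. Each misses at most
    \<open>card W / (4 * m)\<close> points and there are at most \<open>m\<close>, so at least three
    quarters of \<open>W\<close> are joined to every \<open>r i\<close> in colour
    \<open>i\<close>.\<close>
  define r where "r = inv_into V0 clr"
  have r: "r i \<in> V0 \<and> clr (r i) = i" if "i \<in> I" for i
    using that unfolding I_def r_def by (simp add: inv_into_into f_inv_into_f)
  define W' where "W' = W - (\<Union>i\<in>I. miss (r i))"
  have "edge_colouring col (K - I) W'"
  proof (rule edge_colouring_avoiding[OF edge])
    show "W' \<subseteq> V" using WV by (auto simp: W'_def)
    fix y z i assume yz: "y \<in> W'" "z \<in> W'" "y \<noteq> z" and i: "i \<in> I"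
    have *: "r i \<in> V" "y \<in> V" "z \<in> V" using r[OF i] V0 yz WV by (auto simp: W'_def)
    have "y \<in> W" "z \<in> W" "y \<notin> miss (r i)" "z \<notin> miss (r i)" using yz i by (auto simp: W'_def)
    then have "y \<noteq> r i" "z \<noteq> r i" "i \<in> col (r i) y" "i \<in> col (r i) z"
      using r[OF i] by (simp_all add: miss_def)
    moreover have "i \<in> K" using i IK by blast
    ultimately show "i \<notin> col y z"
      using no_triangle[of "r i" y z i] * yz(3) by blast
  qed
  moreover have "card W \<le> 2 * card W'"
  proof -
    have "4 * m * (\<Sum>i\<in>I. card (miss (r i))) = (\<Sum>i\<in>I. 4 * m * card (miss (r i)))"
      by (simp add: sum_distrib_left)
    also have "\<dots> \<le> (\<Sum>i\<in>I. card W)" using miss r by (intro sum_mono) blast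
    also have "\<dots> = card I * card W" by simp
    also have "\<dots> \<le> m * card W"
      using card_mono[OF assms(2) IK] m(1) by (intro mult_le_mono1) linarith
    finally have "4 * (\<Sum>i\<in>I. card (miss (r i))) \<le> card W" using m(2) by simp
    moreover have "card (\<Union>i\<in>I. miss (r i)) \<le> (\<Sum>i\<in>I. card (miss (r i)))"
      by (rule card_UN_le[OF finI])
    moreover have "card W - card (\<Union>i\<in>I. miss (r i)) \<le> card W'"
      unfolding W'_def by (rule diff_card_le_card_Diff) (use finI fmiss in auto)
    ultimately show ?thesis by linarith
  qed
  moreover have "W' \<subseteq> V" using WV by (auto simp: W'_def)
  ultimately show thesis using that[OF IK P1] by blast
qed

text \<open>Strong induction on the number of colours, at a price of \<open>B\<close> per colour
  lost. If \<open>card I \<le> L\<close>, each of the \<open>card I\<close> classes has one colour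
  less, for a total factor of at most \<open>3 * L\<close>. Otherwise more than \<open>L\<close>
  colours go at once, which pays for the factor \<open>2 * k\<close>.\<close>

lemma triangle_free_card_le:
  fixes col :: "'a \<Rightarrow> 'a \<Rightarrow> 'c set" and B :: real
  assumes "finite V" "finite K" "card K \<le> m" "1 \<le> m"
    and "edge_colouring col K V" "triangle_free col K V"
    and close: "\<And>U. U \<subseteq> V \<Longrightarrow> U \<noteq> {} \<Longrightarrow> \<exists>x\<in>U. card U \<le> k * card (close_class col m U x)"
    and k: "1 \<le> k" and B: "1 \<le> B" "3 * real L \<le> B" "2 * real k \<le> B ^ L"
  shows "real (card V) \<le> real (8 * m * k) * B ^ card K"
  using assms(1-7)
proof (induction "card K" arbitrary: K V rule: less_induct)
  case less
  show ?case
  proof (cases "card V \<le> 8 * m * k")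
    case True
    have "real (card V) \<le> real (8 * m * k) * 1" using True by (metis mult.right_neutral of_nat_le_iff)
    also have "\<dots> \<le> real (8 * m * k) * B ^ card K"
      using B(1) by (intro mult_left_mono) auto
    finally show ?thesis by simp
  next
    case False
    then have "V \<noteq> {}" by auto
    then obtain x0 where x0: "x0 \<in> V" "card V \<le> k * card (close_class col m V x0)"
      using less.prems(7)[of V] by blast
    define W where "W = close_class col m V x0"
    have "8 * m * k < k * card W" using x0(2) False unfolding W_def by linarith
    then have "k * (8 * m) < k * card W" by (simp only: ac_simps)
    then have large: "8 * m \<le> card W" by (simp only: mult_less_cancel1 less_imp_le)
    obtain I where I: "I \<subseteq> K"
      "\<exists>f :: 'c \<Rightarrow> 'a set. card V \<le> 3 * (\<Sum>i\<in>I. card (f i)) \<and>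
         (\<forall>i\<in>I. f i \<subseteq> V \<and> edge_colouring col (K - {i}) (f i))"
      "\<exists>W'\<subseteq>V. card W \<le> 2 * card W' \<and> edge_colouring col (K - I) W'"
      using avoid_colours_step[OF less.prems(1-6) W_def x0(1) large] by metis
    have IH: "real (card U) \<le> real (8 * m * k) * B ^ card (K - J)"
      if "U \<subseteq> V" "edge_colouring col (K - J) U" "J \<subseteq> K" "J \<noteq> {}" for U J
    proof (rule less.hyps)
      show "card (K - J) < card K" using that less.prems(2) by (intro psubset_card_mono) auto
      then show "card (K - J) \<le> m" using less.prems(3) by simp
      show "triangle_free col (K - J) U" using less.prems(6) that by (auto intro: triangle_free_mono)
      show "finite U" using that(1) less.prems(1) finite_subset by blast
    qed (use that less.prems in auto)
    have finI: "finite I" using I(1) less.prems(2) finite_subset by blast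
    \<comment> \<open>An empty \<open>I\<close> would force \<open>V\<close> to be empty. Hence a
      colour is always lost, and with no colours left only the small case can occur.\<close>
    have Ine: "I \<noteq> {}" using I(2) \<open>V \<noteq> {}\<close> less.prems(1) by auto
    have IK: "card I \<le> card K" by (rule card_mono[OF less.prems(2) I(1)])
    show ?thesis
    proof (cases "card I \<le> L")
      case True
      obtain f :: "'c \<Rightarrow> 'a set" where f: "card V \<le> 3 * (\<Sum>i\<in>I. card (f i))"
        "\<And>i. i \<in> I \<Longrightarrow> f i \<subseteq> V \<and> edge_colouring col (K - {i}) (f i)"
        using I(2) by blast
      have K: "card K = Suc (card K - 1)" using IK Ine finI by (metis Suc_diff_1 card_gt_0_iff order_less_le_trans)
      have "real (card V) \<le> 3 * (\<Sum>i\<in>I. real (card (f i)))"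
        using f(1) by (metis of_nat_le_iff of_nat_mult of_nat_numeral of_nat_sum)
      also have "\<dots> \<le> 3 * (\<Sum>i\<in>I. real (8 * m * k) * B ^ (card K - 1))"
      proof (intro mult_left_mono sum_mono)
        fix i assume i: "i \<in> I"
        then have "i \<in> K" using I(1) by blast
        then show "real (card (f i)) \<le> real (8 * m * k) * B ^ (card K - 1)"
          using IH[of "f i" "{i}"] f(2)[OF i] less.prems(2) by (simp add: card_Diff_singleton)
      qed auto
      also have "\<dots> = (3 * real (card I)) * (real (8 * m * k) * B ^ (card K - 1))" by simp
      also have "\<dots> \<le> B * (real (8 * m * k) * B ^ (card K - 1))"
        using True B by (intro mult_right_mono) auto
      also have "\<dots> = real (8 * m * k) * B ^ card K" by (subst (2) K) (simp only: power_Suc ac_simps)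
      finally show ?thesis .
    next
      case False
      obtain W' where W': "W' \<subseteq> V" "card W \<le> 2 * card W'" "edge_colouring col (K - I) W'"
        using I(3) by blast
      have "card V \<le> k * (2 * card W')"
        using x0(2) W'(2) unfolding W_def by (meson le_trans mult_le_mono2)
      then have "real (card V) \<le> real k * (2 * real (card W'))"
        by (metis of_nat_le_iff of_nat_mult of_nat_numeral)
      also have "\<dots> = 2 * real k * real (card W')" by simp
      also have "\<dots> \<le> B ^ L * (real (8 * m * k) * B ^ card (K - I))"
        using IH[OF W'(1,3) I(1) Ine] B by (intro mult_mono) auto
      also have "\<dots> \<le> B ^ card I * (real (8 * m * k) * B ^ card (K - I))"
        using False B by (intro mult_right_mono power_increasing) auto
      also have "\<dots> = real (8 * m * k) * B ^ card K"
        using IK card_Diff_subset[OF finI I(1)] by (simp flip: power_add)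
      finally show ?thesis .
    qed
  qed
qed

section \<open>Choice of constants and numerical estimates\<close>

text \<open>Parameters for the packing bound: \<open>k = m ^ c\<close>,
  \<open>s = 32 * c * m ^ 2\<close> and \<open>\<epsilon> = 1 / (16 * m)\<close>. Although
  \<open>s\<close> grows with \<open>c\<close>, the pattern count is polynomial in \<open>c\<close>
  while \<open>m ^ c\<close> is exponential in it.\<close>

lemma exists_exponent:
  assumes "1 \<le> D"
  shows "\<exists>c\<ge>1. \<forall>m\<ge>3. (m * t * (32 * c * m ^ 2) + 1) ^ D < m ^ (c :: nat) \<and>
    real (m ^ c) ^ 2 * (1 - 1 / (16 * real m)) ^ (32 * c * m ^ 2) < 1"
proof -
  \<comment> \<open>The factor \<open>27 = 3 ^ 3\<close> sets aside \<open>3 ^ (3 * D)\<close>, to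
    make room for the factor \<open>m ^ (3 * D)\<close> of the pattern count. With
    \<open>c = n * D\<close>, taking \<open>D\<close>-th powers turns \<open>3 ^ n\<close> into
    \<open>3 ^ c\<close>.\<close>
  define a where "a = 27 * (32 * t * D + 1)"
  have "\<forall>\<^sub>F n in sequentially. real a * real n < 3 ^ n" by real_asymp
  moreover have "\<forall>\<^sub>F n in sequentially. 1 \<le> (n :: nat)" by (rule eventually_ge_at_top)
  ultimately have "\<forall>\<^sub>F n in sequentially. real a * real n < 3 ^ n \<and> 1 \<le> n" by (rule eventually_conj)
  then obtain n where n: "real a * real n < 3 ^ n" "1 \<le> n"
    by (metis (mono_tags, lifting) eventually_happens' sequentially_bot)
  define c where "c = n * D"
  have c: "1 \<le> c" using n assms by (simp add: c_def)
  have "real (a * n) < real (3 ^ n)" using n by simp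
  then have "a * n < 3 ^ n" by (simp only: of_nat_less_iff)
  moreover have "27 * (32 * t * c + 1) \<le> a * n"
    using n(2) by (simp add: a_def c_def algebra_simps)
  ultimately have "27 * (32 * t * c + 1) < 3 ^ n" by linarith
  then have "(27 * (32 * t * c + 1)) ^ D < (3 ^ n) ^ D" using assms by (intro power_strict_mono) auto
  then have c2: "27 ^ D * (32 * t * c + 1) ^ D < 3 ^ c"
    by (simp only: power_mult_distrib c_def power_mult)
  have p27: "(27 :: nat) ^ D = 3 ^ (3 * D)" by (simp add: power_mult)
  have "(3 :: nat) ^ (3 * D) * 1 \<le> 27 ^ D * (32 * t * c + 1) ^ D"
    unfolding p27 by (intro mult_le_mono2) simp
  then have "(3 :: nat) ^ (3 * D) < 3 ^ c" using c2 by linarith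
  then have cD: "3 * D < c" by (simp add: power_strict_increasing_iff)
  have "3 ^ c = 27 ^ D * (3 :: nat) ^ (c - 3 * D)"
    unfolding p27 using cD by (simp flip: power_add)
  then have c3: "(32 * t * c + 1) ^ D < 3 ^ (c - 3 * D)" using c2 by simp
  have "(m * t * (32 * c * m ^ 2) + 1) ^ D < m ^ c" if m: "3 \<le> m" for m
  proof -
    have "1 \<le> m ^ 3" using m by simp
    then have "m * t * (32 * c * m ^ 2) + 1 \<le> (32 * t * c + 1) * m ^ 3"
      by (simp add: algebra_simps power2_eq_square power3_eq_cube)
    then have "(m * t * (32 * c * m ^ 2) + 1) ^ D \<le> ((32 * t * c + 1) * m ^ 3) ^ D"
      by (rule power_mono) simp
    also have "\<dots> = (32 * t * c + 1) ^ D * m ^ (3 * D)" by (simp only: power_mult_distrib power_mult)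
    also have "\<dots> < 3 ^ (c - 3 * D) * m ^ (3 * D)" using c3 m by simp
    also have "\<dots> \<le> m ^ (c - 3 * D) * m ^ (3 * D)" using m by (intro mult_le_mono1 power_mono) auto
    also have "\<dots> = m ^ c" using cD by (simp flip: power_add)
    finally show ?thesis .
  qed
  moreover have "real (m ^ c) ^ 2 * (1 - 1 / (16 * real m)) ^ (32 * c * m ^ 2) < 1" if m: "3 \<le> m" for m
  proof -
    \<comment> \<open>By \<open>1 - u \<le> exp (- u)\<close> the power is at most
      \<open>exp (- (2 * c * m))\<close>, since
      \<open>32 * c * m ^ 2 / (16 * m) = 2 * c * m\<close>; this beats
      \<open>m ^ (2 * c)\<close>.\<close>
    have "1 - 1 / (16 * real m) \<le> exp (- (1 / (16 * real m)))"
      using exp_ge_add_one_self[of "- (1 / (16 * real m))"] by simp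
    then have "(1 - 1 / (16 * real m)) ^ (32 * c * m ^ 2) \<le> exp (- (1 / (16 * real m))) ^ (32 * c * m ^ 2)"
      using m by (intro power_mono) (auto simp: field_simps)
    also have "\<dots> = exp (- (2 * c * real m))"
      using m by (simp flip: exp_of_nat_mult add: field_simps power2_eq_square)
    finally have 1: "(1 - 1 / (16 * real m)) ^ (32 * c * m ^ 2) \<le> exp (- (2 * c * real m))" .
    have "real m < exp (real m)" using exp_gt_self by blast
    then have "real m ^ (2 * c) < exp (real m) ^ (2 * c)" using c by (intro power_strict_mono) auto
    also have "\<dots> = exp (2 * c * real m)" by (simp flip: exp_of_nat_mult)
    finally have 2: "real (m ^ c) ^ 2 < exp (2 * c * real m)" by (simp flip: power_mult add: mult.commute)
    have "real (m ^ c) ^ 2 * (1 - 1 / (16 * real m)) ^ (32 * c * m ^ 2)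
        \<le> real (m ^ c) ^ 2 * exp (- (2 * c * real m))"
      by (intro mult_left_mono 1) simp
    also have "\<dots> < exp (2 * c * real m) * exp (- (2 * c * real m))"
      by (intro mult_strict_right_mono 2) simp
    also have "\<dots> = 1" by (simp flip: exp_add)
    finally show ?thesis .
  qed
  ultimately show ?thesis using c by blast
qed

text \<open>Reduces to \<open>8 \<le> 9\<close> and \<open>2 \<le> 9 / 4\<close>. A positive lower
  bound lets additive constants be absorbed into multiples of
  \<open>log 2 (log 2 m)\<close>.\<close>

lemma log_log_ge_half:
  assumes "3 \<le> (m :: nat)"
  shows "1 / 2 \<le> log 2 (log 2 (real m))"
proof -
  have "(2 :: real) powr (3 / 2) \<le> 3"
  proof (rule power2_le_imp_le)
    show "((2 :: real) powr (3 / 2))\<^sup>2 \<le> 3\<^sup>2" by (simp add: powr_power)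
  qed simp
  then have "3 / 2 \<le> log 2 (3 :: real)" by (subst le_log_iff) auto
  also have "\<dots> \<le> log 2 (real m)" using assms by simp
  finally have *: "3 / 2 \<le> log 2 (real m)" .
  have "((2 :: real) powr (1 / 2)) \<le> 3 / 2"
  proof (rule power2_le_imp_le)
    show "((2 :: real) powr (1 / 2))\<^sup>2 \<le> (3 / 2)\<^sup>2" by (subst powr_power) (auto simp: power2_eq_square)
  qed simp
  with * have "2 powr (1 / 2) \<le> log 2 (real m)" by linarith
  with * show ?thesis by (subst le_log_iff) auto
qed

text \<open>As \<open>2 ^ L \<ge> m\<close>, the factor \<open>2 ^ (c + 1)\<close> of
  \<open>B\<close> already gives \<open>B ^ L \<ge> m ^ (c + 1) \<ge> 2 * m ^ c\<close>, while for
  fixed \<open>c\<close> the base \<open>B\<close> remains of order \<open>log 2 m\<close>. The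
  summand 1 leaves room for rounding to an integer.\<close>

lemma final_estimate:
  fixes c m :: nat
  assumes "3 \<le> (m :: nat)"
  defines "L \<equiv> nat \<lceil>log 2 (real m)\<rceil>"
  defines "B \<equiv> 2 ^ (c + 1) * (3 * real L)"
  shows "1 \<le> B" "3 * real L \<le> B" "2 * real (m ^ c) \<le> B ^ L"
    "8 * m * real (m ^ c) * B ^ m + 1 < 2 powr ((4 * c + 22) * real m * log 2 (log 2 (real m)))"
proof -
  let ?ll = "log 2 (log 2 (real m))"
  have ll: "1 / 2 \<le> ?ll" by (rule log_log_ge_half[OF assms(1)])
  have lm: "1 < log 2 (real m)" using assms(1) by simp
  have L: "log 2 (real m) \<le> real L" "real L \<le> 2 * log 2 (real m)" "1 \<le> real L"
    using lm unfolding L_def by linarith+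
  have pow1: "1 \<le> (2 :: real) ^ (c + 1)" by (rule one_le_power) simp
  show B3: "3 * real L \<le> B" using mult_right_mono[OF pow1, of "3 * real L"] by (simp add: B_def)
  then show B1: "1 \<le> B" using L by linarith
  have "2 * real (m ^ c) \<le> real m * real m ^ c" using assms(1) by (simp add: mult_right_mono)
  also have "\<dots> = real m ^ (c + 1)" by simp
  also have "\<dots> \<le> (2 ^ L) ^ (c + 1)"
  proof (rule power_mono)
    have "real m = 2 powr (log 2 (real m))" using assms(1) by simp
    also have "\<dots> \<le> 2 powr real L" using L(1) by simp
    also have "\<dots> = 2 ^ L" by (simp add: powr_realpow)
    finally show "real m \<le> 2 ^ L" .
  qed simp
  also have "\<dots> = (2 ^ (c + 1)) ^ L" by (simp flip: power_mult add: mult.commute)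
  also have "\<dots> \<le> B ^ L"
  proof (rule power_mono)
    show "2 ^ (c + 1) \<le> B" unfolding B_def using L(3) by (simp add: mult_le_cancel_left1)
  qed simp
  finally show "2 * real (m ^ c) \<le> B ^ L" .
  have "B \<le> 2 ^ (c + 1) * (2 ^ 3 * log 2 (real m))"
    unfolding B_def using L(2) lm by (intro mult_left_mono) auto
  also have "\<dots> = 2 powr (c + 4) * 2 powr ?ll"
    using lm by (simp add: powr_realpow[symmetric] powr_add)
  also have "\<dots> = 2 powr (c + 4 + ?ll)" by (simp add: powr_add)
  also have "\<dots> \<le> 2 powr ((2 * c + 9) * ?ll)"
  proof (intro powr_mono)
    have "(2 * real c + 8) * (1 / 2) \<le> (2 * real c + 8) * ?ll" using ll by (intro mult_left_mono) auto
    then show "c + 4 + ?ll \<le> (2 * c + 9) * ?ll" by (simp add: algebra_simps)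
  qed simp
  finally have "B ^ m \<le> (2 powr ((2 * c + 9) * ?ll)) ^ m" using B1 by (intro power_mono) auto
  also have "\<dots> = 2 powr ((2 * c + 9) * ?ll * m)" by (simp add: powr_power mult.commute)
  finally have Bm: "B ^ m \<le> 2 powr ((2 * c + 9) * ?ll * m)" .
  have mle: "real m \<le> 2 powr real m"
    by (metis less_exp of_nat_le_iff of_nat_numeral of_nat_power powr_realpow less_imp_le zero_less_numeral)
  have "1 \<le> 8 * m * real (m ^ c) * B ^ m"
  proof -
    have "1 * 1 \<le> (8 * m * real (m ^ c)) * B ^ m"
    proof (rule mult_mono)
      have "1 \<le> 8 * m * m ^ c" using assms(1) by (simp add: Suc_leI)
      then show "1 \<le> 8 * m * real (m ^ c)" by (metis of_nat_1 of_nat_le_iff of_nat_mult of_nat_numeral)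
    qed (use B1 in auto)
    then show ?thesis by (simp only: mult_1)
  qed
  then have "8 * m * real (m ^ c) * B ^ m + 1 \<le> 2 ^ 4 * real m ^ (c + 1) * B ^ m"
    by (simp add: ac_simps)
  also have "\<dots> \<le> 2 ^ 4 * (2 powr real m) ^ (c + 1) * 2 powr ((2 * c + 9) * ?ll * m)"
    using B1 by (intro mult_mono power_mono mle Bm) auto
  also have "\<dots> = 2 powr 4 * 2 powr (m * (c + 1)) * 2 powr ((2 * c + 9) * ?ll * m)"
    by (simp add: powr_power powr_add[symmetric] algebra_simps)
  also have "\<dots> = 2 powr (4 + m * (c + 1) + (2 * c + 9) * ?ll * m)"
    by (simp only: powr_add of_nat_add of_nat_numeral)
  also have "\<dots> < 2 powr ((4 * c + 22) * real m * ?ll)"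
  proof (rule powr_less_mono)
    \<comment> \<open>Of the coefficient \<open>4 * c + 22\<close>, the part
      \<open>2 * c + 9\<close> serves \<open>B ^ m\<close> and the remaining
      \<open>2 * c + 13\<close> absorbs the prefactor.\<close>
    have "(2 * real c + 13) * m * (1 / 2) \<le> (2 * real c + 13) * m * ?ll" using ll by (intro mult_left_mono) auto
    moreover have "4 + real m * (real c + 1) < (2 * real c + 13) * m * (1 / 2)"
      using assms(1) by (simp add: algebra_simps)
    ultimately show "4 + m * (c + 1) + (2 * c + 9) * ?ll * m < (4 * c + 22) * real m * ?ll"
      by (simp add: algebra_simps)
  qed simp
  finally show "8 * m * real (m ^ c) * B ^ m + 1 < 2 powr ((4 * c + 22) * real m * ?ll)" .
qed

section \<open>Application to semi-algebraic relations\<close>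

text \<open>Without a monochromatic triangle, the sets of indices whose conditions hold form a
  triangle-free colouring of \<open>N\<close> points, and the recursive bound contradicts the size
  of \<open>N\<close>.\<close>

lemma semialg_triangle_propertyI:
  fixes c m t L N :: nat and B :: real
  defines "D \<equiv> card (exponents_upto t :: ('d::finite \<Rightarrow> nat) set)"
  assumes m: "3 \<le> m"
    and c: "(m * t * (32 * c * m ^ 2) + 1) ^ D < m ^ c"
      "real (m ^ c) ^ 2 * (1 - 1 / (16 * real m)) ^ (32 * c * m ^ 2) < 1"
    and B: "1 \<le> B" "3 * real L \<le> B" "2 * real (m ^ c) \<le> B ^ L"
    and N: "8 * m * real (m ^ c) * B ^ m < N"
  shows "semialg_triangle_property TYPE('d) t m N"
  unfolding semialg_triangle_property_def
proof (intro allI impI, rule ccontr)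
  fix p :: "nat \<Rightarrow> real ^ 'd" and E
  assume inj: "inj_on p {1..N}"
    and sym: "\<forall>i\<in>{1..m}. symmetric_semialg_relation t N p (E i)"
    and cover: "nsets (p ` {1..N}) 2 = (\<Union>i\<in>{1..m}. E i)"
    and no: "\<not> (\<exists>T\<in>nsets (p ` {1..N}) 3. \<exists>i\<in>{1..m}. nsets T 2 \<subseteq> E i)"
  let ?V = "p ` {1..N}"
  from sym have "\<forall>i\<in>{1..m}. \<exists>fs \<Phi>. semialg_description t fs \<Phi> N p (E i) \<and>
        (\<forall>a\<in>{1..N}. \<forall>b\<in>{1..N}. a \<noteq> b \<longrightarrow>
           (semialg_condition fs \<Phi> (p a) (p b) \<longleftrightarrow> semialg_condition fs \<Phi> (p b) (p a)))"
    unfolding symmetric_semialg_relation_def by blast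
  then obtain fs \<Phi> where desc: "\<And>i. i \<in> {1..m} \<Longrightarrow> semialg_description t (fs i) (\<Phi> i) N p (E i)"
    and csym: "\<And>i a b. i \<in> {1..m} \<Longrightarrow> a \<in> {1..N} \<Longrightarrow> b \<in> {1..N} \<Longrightarrow> a \<noteq> b \<Longrightarrow>
       semialg_condition (fs i) (\<Phi> i) (p a) (p b) \<longleftrightarrow> semialg_condition (fs i) (\<Phi> i) (p b) (p a)"
    by metis
  define col where "col = cond_colours m fs \<Phi>"
  have edge_iff: "{x, y} \<in> E i \<longleftrightarrow> i \<in> col x y"
    if x: "x \<in> ?V" and y: "y \<in> ?V" and "x \<noteq> y" and i: "i \<in> {1..m}" for x y i
  proof -
    obtain a where a: "a \<in> {1..N}" "x = p a" using x by blast
    obtain b where b: "b \<in> {1..N}" "y = p b" using y by blast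
    \<comment> \<open>The description decides membership only for increasing indices; the symmetry
      of the condition covers the other order.\<close>
    have ordered: "{p u, p v} \<in> E i \<longleftrightarrow> semialg_condition (fs i) (\<Phi> i) (p u) (p v)"
      if "u \<in> {1..N}" "v \<in> {1..N}" "u < v" for u v
      using desc[OF i] that unfolding semialg_description_def by blast
    have "a \<noteq> b" using \<open>x \<noteq> y\<close> a b by blast
    then have "{p a, p b} \<in> E i \<longleftrightarrow> semialg_condition (fs i) (\<Phi> i) (p a) (p b)"
      using ordered[of a b] ordered[of b a] csym[OF i, of a b] a(1) b(1)
      by (cases "a < b") (simp_all add: insert_commute)
    then show ?thesis using a(2) b(2) i by (simp add: col_def cond_colours_def)
  qed
  have edge: "edge_colouring col {1..m} ?V"
    unfolding edge_colouring_def
  proof (intro ballI impI conjI)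
    fix x y assume xy: "x \<in> ?V" "y \<in> ?V" "x \<noteq> y"
    have "col x y \<subseteq> {1..m}" "col y x \<subseteq> {1..m}" by (auto simp: col_def cond_colours_def)
    then show "col x y = col y x"
      using edge_iff[of x y] edge_iff[of y x] xy by (auto simp: insert_commute)
    have "{x, y} \<in> nsets ?V 2" using xy by (auto simp: nsets_def)
    then obtain i where "i \<in> {1..m}" "{x, y} \<in> E i" unfolding cover by blast
    then show "col x y \<inter> {1..m} \<noteq> {}" using edge_iff xy by auto
  qed
  have tf: "triangle_free col {1..m} ?V"
    unfolding triangle_free_def
  proof (intro ballI impI, rule ccontr)
    fix x y z assume xyz: "x \<in> ?V" "y \<in> ?V" "z \<in> ?V" "x \<noteq> y" "y \<noteq> z" "x \<noteq> z"
      and "{1..m} \<inter> col x y \<inter> col y z \<inter> col x z \<noteq> {}"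
    then obtain i where i: "i \<in> {1..m}" "i \<in> col x y" "i \<in> col y z" "i \<in> col x z" by blast
    have "{x, y} \<in> E i" "{y, z} \<in> E i" "{x, z} \<in> E i"
      using i xyz edge_iff by blast+
    moreover have "nsets {x, y, z} 2 \<subseteq> {{x, y}, {y, z}, {x, z}}"
      by (auto simp: nsets_2_eq doubleton_eq_iff insert_commute)
    ultimately have "nsets {x, y, z} 2 \<subseteq> E i" by blast
    moreover have "{x, y, z} \<in> nsets ?V 3" using xyz by (auto simp: nsets_def)
    ultimately show False using no i by blast
  qed
  \<comment> \<open>The pattern bound holds on every subset, so packing works with \<open>U\<close>
    itself as the ground set, as the recursion demands.\<close>
  have close: "\<exists>x\<in>U. card U \<le> m ^ c * card (close_class col m U x)" if U: "U \<subseteq> ?V" "U \<noteq> {}" for U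
  proof -
    have finU: "finite U" using U finite_subset by blast
    have "\<exists>x\<in>U. card U \<le> m ^ c * card {y \<in> U. card {q \<in> U. col q x \<noteq> col q y} \<le> 1 / (16 * real m) * card U}"
    proof (rule exists_large_close_class[OF finU U(2)])
      show "real (m ^ c) ^ 2 * (1 - 1 / (16 * real m)) ^ (32 * c * m ^ 2) < 1" by (rule c(2))
      fix S assume S: "S \<subseteq> U" "card S \<le> 32 * c * m ^ 2"
      have "card ((\<lambda>x. restrict (\<lambda>p. col p x) S) ` U) \<le> (m * t * card S + 1) ^ D"
        unfolding col_def D_def
        using desc finU S(1) finite_subset
        by (intro card_colour_patterns_le) (auto simp: semialg_description_def)
      also have "\<dots> \<le> (m * t * (32 * c * m ^ 2) + 1) ^ D"
        using S(2) by (intro power_mono add_mono mult_left_mono) auto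
      also have "\<dots> < m ^ c" by (rule c(1))
      finally show "card ((\<lambda>x. restrict (\<lambda>p. col p x) S) ` U) < m ^ c" .
    qed (use m in \<open>auto simp: field_simps\<close>)
    moreover have "card {q \<in> U. col q x \<noteq> col q y} \<le> 1 / (16 * real m) * card U
        \<longleftrightarrow> 16 * m * card {q \<in> U. col q x \<noteq> col q y} \<le> card U" for x y
    proof -
      have "card {q \<in> U. col q x \<noteq> col q y} \<le> 1 / (16 * real m) * card U
        \<longleftrightarrow> real (16 * m * card {q \<in> U. col q x \<noteq> col q y}) \<le> real (card U)"
        using m by (simp add: field_simps)
      then show ?thesis by (simp only: of_nat_le_iff)
    qed
    ultimately show ?thesis unfolding close_class_def by simp
  qed
  have "real (card ?V) \<le> 8 * m * real (m ^ c) * B ^ card {1..m}"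
    using triangle_free_card_le[of ?V "{1..m}" m col "m ^ c", OF _ _ _ _ edge tf close _ B] m by simp
  then show False using N card_image[OF inj] by simp
qed

theorem theorem6:
  fixes t :: nat
  assumes "t \<ge> 1"
  shows "\<exists>C::real. \<forall>m::nat. m \<ge> 3 \<longrightarrow>
    ereal_of_enat (semialg_ramsey TYPE('d::finite) t m)
      < ereal (2 powr (C * real m * log 2 (log 2 (real m))))"
proof -
  define D where "D = card (exponents_upto t :: ('d \<Rightarrow> nat) set)"
  have "(\<lambda>_. 0) \<in> (exponents_upto t :: ('d \<Rightarrow> nat) set)" by (auto simp: exponents_upto_def)
  then have "1 \<le> D"
    unfolding D_def using finite_exponents_upto by (metis One_nat_def Suc_leI card_gt_0_iff empty_iff)
  then obtain c where c: "\<And>m. 3 \<le> m \<Longrightarrow> (m * t * (32 * c * m ^ 2) + 1) ^ D < m ^ c \<and>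
    real (m ^ c) ^ 2 * (1 - 1 / (16 * real m)) ^ (32 * c * m ^ 2) < 1"
    using exists_exponent by metis
  show ?thesis
  \<comment> \<open>\<open>c\<close> was chosen from \<open>t\<close> and \<open>D\<close> before
    \<open>m\<close>, so the constant depends only on \<open>t\<close> and the dimension.\<close>
  proof (intro exI[of _ "4 * real c + 22"] allI impI)
    fix m :: nat assume m: "3 \<le> m"
    define L where "L = nat \<lceil>log 2 (real m)\<rceil>"
    define B where "B = 2 ^ (c + 1) * (3 * real L)"
    note B = final_estimate[OF m, of c, folded L_def, folded B_def]
    define N where "N = nat \<lfloor>8 * m * real (m ^ c) * B ^ m\<rfloor> + 1"
    have N: "8 * m * real (m ^ c) * B ^ m < N" unfolding N_def by linarith
    have "0 \<le> 8 * m * real (m ^ c) * B ^ m" using B(1) by simp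
    then have N': "real N \<le> 8 * m * real (m ^ c) * B ^ m + 1" unfolding N_def by linarith
    have "semialg_triangle_property TYPE('d) t m N"
      using semialg_triangle_propertyI[OF m _ _ B(1-3) N] c[OF m] unfolding D_def by blast
    \<comment> \<open>One \<open>N\<close> with the property bounds the infimum and so rules out the
      value \<open>\<infinity>\<close>.\<close>
    then have "semialg_ramsey TYPE('d) t m \<le> enat N"
      unfolding semialg_ramsey_def by (intro Inf_lower) auto
    then have "ereal_of_enat (semialg_ramsey TYPE('d) t m) \<le> ereal_of_enat (enat N)"
      by (simp only: ereal_of_enat_le_iff)
    also have "\<dots> = ereal (real N)" by simp
    also have "\<dots> < ereal (2 powr ((4 * real c + 22) * real m * log 2 (log 2 (real m))))"
      using N' B(4) by simp
    finally show "ereal_of_enat (semialg_ramsey TYPE('d) t m)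
      < ereal (2 powr ((4 * real c + 22) * real m * log 2 (log 2 (real m))))" .
  qed
qed

end
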